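(* If $n\equiv 0\pmod 4$, then any two graphs in $\mathcal{K}_n$ are connected by a path in $\mathcal{G}_n^*$.
   Context: $\mathcal{G}_n$ is the set of simple 3-regular graphs on vertex set $[n]$. A make move ${\tt make}(yxvwz)$ applies to $G=(V,E)$ when $y,x,v,w,z$ are distinct, $yx,xv,vw,wz\in E$ and $xw,yz\notin E$, and replaces $E$ by $(E\setminus\{xy,wz\})\cup\{xw,yz\}$. A break move ${\tt break}(vxw,yz)$ applies when $vxwv$ is a triangle, $yz\in E$, $\{y,z\}\cap\{v,x,w\}=\emptyset$ and $xy,wz\notin E$, and replaces $E$ by $(E\setminus\{xw,yz\})\cup\{xy,wz\}$. $\mathcal{G}_n^*$ is the graph on vertex set $\mathcal{G}_n$ with $G,G'$ adjacent iff a make or break move takes $G$ to $G'$. $\mathcal{K}_n$ is the set of graphs in $\mathcal{G}_n$ consisting of $n/4$ connected components each isomorphic to $K_4$. *)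

theory Defs
  imports "Graph_Theory.Graph_Theory"
begin

text \<open>
  A simple graph is a finite symmetric loop-free digraph without parallel arcs
  (locale \<^locale>\<open>pair_graph\<close>): the undirected edge \<open>uv\<close> is the pair of arcs \<open>(u, v)\<close>, \<open>(v, u)\<close>.
\<close>

definition edge :: "'a \<Rightarrow> 'a \<Rightarrow> ('a \<times> 'a) set" where
  "edge u v = {(u, v), (v, u)}"

definition replace_edges ::
  "'a pair_pre_digraph \<Rightarrow> ('a \<times> 'a) set \<Rightarrow> ('a \<times> 'a) set \<Rightarrow> 'a pair_pre_digraph" where
  "replace_edges G R A = \<lparr> pverts = pverts G, parcs = (parcs G - R) \<union> A \<rparr>"

definition cubic_graphs :: "nat \<Rightarrow> nat pair_pre_digraph set" where
  "cubic_graphs n =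
     {G. pair_graph G \<and> pverts G = {1..n} \<and> (\<forall>v \<in> pverts G. out_degree (with_proj G) v = 3)}"

definition make_applies :: "'a pair_pre_digraph \<Rightarrow> 'a \<Rightarrow> 'a \<Rightarrow> 'a \<Rightarrow> 'a \<Rightarrow> 'a \<Rightarrow> bool" where
  "make_applies G y x v w z \<longleftrightarrow>
     distinct [y, x, v, w, z] \<and>
     (y, x) \<in> parcs G \<and> (x, v) \<in> parcs G \<and> (v, w) \<in> parcs G \<and> (w, z) \<in> parcs G \<and>
     (x, w) \<notin> parcs G \<and> (y, z) \<notin> parcs G"

definition make_move ::
  "'a pair_pre_digraph \<Rightarrow> 'a \<Rightarrow> 'a \<Rightarrow> 'a \<Rightarrow> 'a \<Rightarrow> 'a \<Rightarrow> 'a pair_pre_digraph" where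
  "make_move G y x v w z =
     replace_edges G (edge x y \<union> edge w z) (edge x w \<union> edge y z)"

definition break_applies :: "'a pair_pre_digraph \<Rightarrow> 'a \<Rightarrow> 'a \<Rightarrow> 'a \<Rightarrow> 'a \<Rightarrow> 'a \<Rightarrow> bool" where
  "break_applies G v x w y z \<longleftrightarrow>
     (v, x) \<in> parcs G \<and> (x, w) \<in> parcs G \<and> (w, v) \<in> parcs G \<and>
     (y, z) \<in> parcs G \<and> {y, z} \<inter> {v, x, w} = {} \<and>
     (x, y) \<notin> parcs G \<and> (w, z) \<notin> parcs G"

definition break_move ::
  "'a pair_pre_digraph \<Rightarrow> 'a \<Rightarrow> 'a \<Rightarrow> 'a \<Rightarrow> 'a \<Rightarrow> 'a \<Rightarrow> 'a pair_pre_digraph" where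
  "break_move G v x w y z =
     replace_edges G (edge x w \<union> edge y z) (edge x y \<union> edge w z)"

definition takes_to :: "'a pair_pre_digraph \<Rightarrow> 'a pair_pre_digraph \<Rightarrow> bool" where
  "takes_to G G' \<longleftrightarrow>
     (\<exists>y x v w z. make_applies G y x v w z \<and> G' = make_move G y x v w z) \<or>
     (\<exists>v x w y z. break_applies G v x w y z \<and> G' = break_move G v x w y z)"

text \<open>The vertices of this graph are themselves graphs; it is a simple graph by \<open>pair_graph_flip_graph\<close>.\<close>

definition flip_graph :: "nat \<Rightarrow> nat pair_pre_digraph pair_pre_digraph" where
  "flip_graph n =
     \<lparr> pverts = cubic_graphs n,
       parcs = {(G, G'). G \<in> cubic_graphs n \<and> G' \<in> cubic_graphs n \<and> takes_to G G'} \<rparr>"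

definition K4 :: "nat pair_pre_digraph" where
  "K4 = \<lparr> pverts = {1..4}, parcs = {(u, v). u \<in> {1..4} \<and> v \<in> {1..4} \<and> u \<noteq> v} \<rparr>"

text \<open>
  For a symmetric digraph the strongly connected components are the connected components.
  The number of components is compared as \<open>4 * card = n\<close> so that \<open>n/4\<close> is not rounded.
\<close>

definition K4_graphs :: "nat \<Rightarrow> nat pair_pre_digraph set" where
  "K4_graphs n =
     {G \<in> cubic_graphs n. 4 * card (pre_digraph.sccs (with_proj G)) = n \<and>
        (\<forall>C \<in> pre_digraph.sccs (with_proj G). digraph_iso C (with_proj K4))}"

lemma complete_digraph_K4: "complete_digraph 4 (with_proj K4)"
  unfolding complete_digraph_pair_def K4_def by auto

lemma cubic_graphs_sym:
  assumes "G \<in> cubic_graphs n" "(u, v) \<in> parcs G"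
  shows "(v, u) \<in> parcs G"
proof -
  interpret pair_graph G using assms(1) by (simp add: cubic_graphs_def)
  show ?thesis using assms(2) by (rule arcs_symmetric)
qed

lemma cubic_graphs_neq:
  assumes "G \<in> cubic_graphs n" "(u, v) \<in> parcs G"
  shows "u \<noteq> v"
proof -
  interpret pair_graph G using assms(1) by (simp add: cubic_graphs_def)
  show ?thesis using pair_no_loops[OF assms(2)] by simp
qed

lemma takes_to_sym:
  assumes G: "G \<in> cubic_graphs n" and t: "takes_to G G'"
  shows "takes_to G' G"
proof -
  note s = cubic_graphs_sym[OF G] and d = cubic_graphs_neq[OF G]
  consider (mk) y x v w z where "make_applies G y x v w z" "G' = make_move G y x v w z"
    | (br) v x w y z where "break_applies G v x w y z" "G' = break_move G v x w y z"
    using t unfolding takes_to_def by blast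
  then show ?thesis
  proof cases
    case mk
    have "break_applies G' v x w y z"
      using mk s unfolding make_applies_def make_move_def break_applies_def replace_edges_def edge_def
      by auto
    moreover have "parcs G = parcs (break_move G' v x w y z)"
      using mk s unfolding make_applies_def make_move_def break_move_def replace_edges_def edge_def
      by auto
    then have "G = break_move G' v x w y z"
      using mk(2) by (cases G) (simp add: break_move_def make_move_def replace_edges_def)
    ultimately show ?thesis unfolding takes_to_def by blast
  next
    case br
    have ne: "distinct [y, x, v, w, z]"
      using br(1) d unfolding break_applies_def by auto
    have "make_applies G' y x v w z"
      using br s ne unfolding make_applies_def break_move_def break_applies_def replace_edges_def edge_def
      by auto
    moreover have "parcs G = parcs (make_move G' y x v w z)"
      using br s ne unfolding break_applies_def make_move_def break_move_def replace_edges_def edge_def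
      by auto
    then have "G = make_move G' y x v w z"
      using br(2) by (cases G) (simp add: break_move_def make_move_def replace_edges_def)
    ultimately show ?thesis unfolding takes_to_def by blast
  qed
qed

lemma takes_to_neq:
  assumes "takes_to G G'"
  shows "G \<noteq> G'"
proof -
  consider (mk) y x v w z where "make_applies G y x v w z" "G' = make_move G y x v w z"
    | (br) v x w y z where "break_applies G v x w y z" "G' = break_move G v x w y z"
    using assms unfolding takes_to_def by blast
  then show ?thesis
  proof cases
    case mk
    then have "(x, w) \<in> parcs G' - parcs G"
      by (auto simp: make_applies_def make_move_def replace_edges_def edge_def)
    then show ?thesis by auto
  next
    case br
    then have "(x, y) \<in> parcs G' - parcs G"
      by (auto simp: break_applies_def break_move_def replace_edges_def edge_def)
    then show ?thesis by auto
  qed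
qed

lemma finite_cubic_graphs: "finite (cubic_graphs n)"
proof (rule finite_subset)
  let ?mk = "\<lambda>A. \<lparr> pverts = {1..n}, parcs = A \<rparr> :: nat pair_pre_digraph"
  show "cubic_graphs n \<subseteq> ?mk ` Pow ({1..n} \<times> {1..n})"
  proof
    fix G assume G: "G \<in> cubic_graphs n"
    then interpret pair_graph G by (simp add: cubic_graphs_def)
    have v: "pverts G = {1..n}" using G by (simp add: cubic_graphs_def)
    have "parcs G \<subseteq> {1..n} \<times> {1..n}"
      using in_arcsD1 in_arcsD2 unfolding v by auto
    moreover have "G = ?mk (parcs G)" using v by (cases G) simp
    ultimately show "G \<in> ?mk ` Pow ({1..n} \<times> {1..n})" by blast
  qed
qed simp

lemma pair_graph_flip_graph: "pair_graph (flip_graph n)"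
proof
  show "finite (parcs (flip_graph n))"
    by (rule finite_subset[of _ "cubic_graphs n \<times> cubic_graphs n"])
       (auto simp: flip_graph_def finite_cubic_graphs)
  show "symmetric (with_proj (flip_graph n))"
    by (auto simp: symmetric_def flip_graph_def intro!: symI intro: takes_to_sym)
  show "fst e \<noteq> snd e" if "e \<in> parcs (flip_graph n)" for e
    using that by (auto simp: flip_graph_def dest: takes_to_neq)
qed (auto simp: flip_graph_def finite_cubic_graphs)

end

theory Submission
  imports Defs "HOL-Combinatorics.Transposition"
begin

text \<open>
  Two breaks followed by one make swap two vertices that lie in different copies of \<open>K\<^sub>4\<close> and leave
  all other components alone. Every partition of the vertices into blocks of size four can be
  turned into every other one by such swaps: make the neighbourhood of one vertex correct,
  one swap at a time, without touching the blocks that are already correct. The only property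
  of a graph in \<open>\<K>\<^sub>n\<close> that this uses is that it is cubic and its reflexive closure is transitive.
\<close>

section \<open>Edge switches inside the cubic graphs\<close>

lemma out_degree_eq_card_Image: "out_degree (with_proj G) u = card (parcs G `` {u})"
proof -
  have "out_arcs (with_proj G) u = Pair u ` (parcs G `` {u})"
    by (auto simp: out_arcs_def)
  then show ?thesis
    by (simp add: out_degree_def card_image inj_on_def)
qed

lemma cubic_graphs_iff:
  "G \<in> cubic_graphs n \<longleftrightarrow>
     pverts G = {1..n} \<and> parcs G \<subseteq> {1..n} \<times> {1..n} \<and> sym (parcs G) \<and> irrefl (parcs G) \<and>
     (\<forall>v \<in> {1..n}. card (parcs G `` {v}) = 3)"  (is "?L \<longleftrightarrow> ?R")
proof
  assume L: ?L
  then interpret pair_graph G by (simp add: cubic_graphs_def)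
  have "parcs G \<subseteq> pverts G \<times> pverts G" by (auto dest: in_arcsD1 in_arcsD2)
  then show ?R using L
    by (auto simp: cubic_graphs_def out_degree_eq_card_Image irrefl_def
        intro!: symI intro: arcs_symmetric dest: pair_no_loops)
next
  assume R: ?R
  then have "finite (parcs G)" by (auto intro: finite_subset)
  with R have "pair_graph G"
    by unfold_locales (auto simp: symmetric_def irrefl_def)
  with R show ?L by (auto simp: cubic_graphs_def out_degree_eq_card_Image)
qed

text \<open>Each of the four vertices trades one neighbour for a former non-neighbour, so degrees
  are kept. This is the common form of both moves: \<open>a b c d\<close> becomes
  \<open>x y w z\<close> for a make and \<open>x w y z\<close> for a break.\<close>

lemma switch_in_cubic_graphs:
  assumes G: "G \<in> cubic_graphs n" and d: "distinct [a, b, c, d]"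
    and ab: "(a, b) \<in> parcs G" and cd: "(c, d) \<in> parcs G"
    and ac: "(a, c) \<notin> parcs G" and bd: "(b, d) \<notin> parcs G"
  shows "replace_edges G (edge a b \<union> edge c d) (edge a c \<union> edge b d) \<in> cubic_graphs n"
    (is "?H \<in> _")
proof -
  note R = G[unfolded cubic_graphs_iff]
  have s: "(u, v) \<in> parcs G \<Longrightarrow> (v, u) \<in> parcs G" for u v
    by (rule cubic_graphs_sym[OF G])
  have V: "a \<in> {1..n}" "b \<in> {1..n}" "c \<in> {1..n}" "d \<in> {1..n}"
    using R ab cd by blast+
  have fin: "finite (parcs G `` {u})" for u
    using R by (auto intro!: finite_subset[of "parcs G `` {u}" "{1..n}"])
  have card_swap: "card (insert q (N - {p})) = card N" if "finite N" "p \<in> N" "q \<notin> N" for p q :: nat and N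
    using that by (metis card.insert card_Suc_Diff1 finite_Diff insert_Diff insertCI)
  have N: "parcs ?H `` {u} =
      (if u = a then insert c (parcs G `` {u} - {b})
       else if u = b then insert d (parcs G `` {u} - {a})
       else if u = c then insert a (parcs G `` {u} - {d})
       else if u = d then insert b (parcs G `` {u} - {c})
       else parcs G `` {u})" for u
    using d by (auto simp: replace_edges_def edge_def)
  have swap: "card (insert q (parcs G `` {u} - {p})) = card (parcs G `` {u})"
    if "(u, p) \<in> parcs G" "(u, q) \<notin> parcs G" for u p q
    using that by (intro card_swap fin) auto
  have "card (parcs ?H `` {u}) = card (parcs G `` {u})" for u
  proof -
    have ca: "(c, a) \<notin> parcs G" and db: "(d, b) \<notin> parcs G"
      using s ac bd by blast+
    consider "u = a" | "u = b" | "u = c" | "u = d" | "u \<notin> {a, b, c, d}" by blast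
    then show ?thesis
    proof cases
      case 1 then show ?thesis using d swap[OF ab ac] by (simp add: N)
    next
      case 2 then show ?thesis using d swap[OF s[OF ab] bd] by (simp add: N)
    next
      case 3 then show ?thesis using d swap[OF cd ca] by (simp add: N)
    next
      case 4 then show ?thesis using d swap[OF s[OF cd] db] by (simp add: N)
    next
      case 5 then show ?thesis by (simp add: N)
    qed
  qed
  moreover have "sym (parcs ?H)"
  proof (rule symI)
    fix u v assume "(u, v) \<in> parcs ?H"
    then show "(v, u) \<in> parcs ?H"
      using s[of u v] by (auto simp: replace_edges_def edge_def)
  qed
  moreover have "irrefl (parcs ?H)"
    using R d by (auto simp: irrefl_def replace_edges_def edge_def)
  moreover have "parcs ?H \<subseteq> {1..n} \<times> {1..n}"
    using R V by (auto simp: replace_edges_def edge_def)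
  ultimately show ?thesis
    using R by (simp add: cubic_graphs_iff) (simp add: replace_edges_def)
qed

lemma takes_to_in_cubic_graphs:
  assumes G: "G \<in> cubic_graphs n" and "takes_to G G'"
  shows "G' \<in> cubic_graphs n"
proof -
  consider (mk) y x v w z where "make_applies G y x v w z" "G' = make_move G y x v w z"
    | (br) v x w y z where "break_applies G v x w y z" "G' = break_move G v x w y z"
    using assms(2) unfolding takes_to_def by blast
  then show ?thesis
  proof cases
    case mk
    then show ?thesis
      using switch_in_cubic_graphs[OF G, of x y w z] cubic_graphs_sym[OF G]
      by (auto simp: make_applies_def make_move_def)
  next
    case br
    then show ?thesis
      using switch_in_cubic_graphs[OF G, of x w y z] cubic_graphs_neq[OF G]
      by (auto simp: break_applies_def break_move_def)
  qed
qed

lemma takes_to_reachable: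
  assumes "G \<in> cubic_graphs n" "takes_to G G'"
  shows "G \<rightarrow>\<^sup>*\<^bsub>flip_graph n\<^esub> G'"
proof -
  interpret F: pair_graph "flip_graph n" by (rule pair_graph_flip_graph)
  have "(G, G') \<in> parcs (flip_graph n)"
    using assms takes_to_in_cubic_graphs by (simp add: flip_graph_def)
  then show ?thesis by (intro F.reachable_adjI) simp
qed

section \<open>Exchanging two vertices of different cliques\<close>

text \<open>Adjacent vertices are equivalent under \<open>E\<^sup>=\<close>, so their closed
  neighbourhoods coincide. One neighbourhood thus determines those of all members of its
  clique.\<close>

lemma Image_trans_reflcl:
  assumes tr: "trans (E\<^sup>=)" and "sym E" "irrefl E" "(u, v) \<in> E"
  shows "E `` {v} = insert u (E `` {u}) - {v}"
proof -
  have vu: "(v, u) \<in> E" using assms by (blast dest: symD)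
  have "w = u \<or> (u, w) \<in> E" if "(v, w) \<in> E" for w
    using transD[OF tr, of u v w] assms(4) that by auto
  moreover have "w = v \<or> (v, w) \<in> E" if "(u, w) \<in> E" for w
    using transD[OF tr, of v u w] vu that by auto
  ultimately show ?thesis using vu assms(3) by (auto simp: irrefl_def)
qed

text \<open>
  Let \<open>{a, a1, a2, a3}\<close> and \<open>{b, b1, b2, b3}\<close> be the two cliques. The moves exchange \<open>a a2, b b1\<close> for
  \<open>a b1, b a2\<close>, then \<open>a a3, b b2\<close> for \<open>a b2, b a3\<close>, and finally \<open>a a1, b b3\<close> for \<open>a b3, b a1\<close>; the
  last one is a make, since it completes the triangles at the new positions of \<open>a\<close> and \<open>b\<close>.
\<close>

lemma reachable_transpose:
  assumes G: "G \<in> cubic_graphs n" and tr: "trans ((parcs G)\<^sup>=)"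
    and V: "a \<in> {1..n}" "b \<in> {1..n}" and ne: "a \<noteq> b" and nadj: "(a, b) \<notin> parcs G"
  shows "G \<rightarrow>\<^sup>*\<^bsub>flip_graph n\<^esub> G\<lparr>parcs := inv_image (parcs G) (transpose a b)\<rparr>"
proof -
  define E where "E = parcs G"
  note R = G[unfolded cubic_graphs_iff, folded E_def]
  have E: "sym E" "irrefl E" "trans (E\<^sup>=)"
    using R tr by (simp_all add: E_def)
  have s: "(u, v) \<in> E \<longleftrightarrow> (v, u) \<in> E" for u v
    using E(1) by (meson symD)
  have irr: "(u, u) \<notin> E" for u using E(2) by (auto simp: irrefl_def)
  have nab: "(a, b) \<notin> E" using nadj by (simp add: E_def)
  have nb: "E `` {v} = insert u (E `` {u}) - {v}" if "(u, v) \<in> E" for u v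
    using Image_trans_reflcl[OF E(3,1,2) that] .
  have "card (E `` {a}) = 3" "card (E `` {b}) = 3"
    using R V by blast+
  then obtain a1 a2 a3 b1 b2 b3 where A: "E `` {a} = {a1, a2, a3}" and da: "distinct [a1, a2, a3]"
    and B: "E `` {b} = {b1, b2, b3}" and db: "distinct [b1, b2, b3]"
    unfolding card_3_iff by auto
  have Aa: "(a, a1) \<in> E" "(a, a2) \<in> E" "(a, a3) \<in> E" and Bb: "(b, b1) \<in> E" "(b, b2) \<in> E" "(b, b3) \<in> E"
    using A B by auto
  \<comment> \<open>A neighbour of \<open>a\<close> that equals \<open>b\<close> or is joined to it
    would force the edge \<open>a b\<close>; hence the two cliques are disjoint.\<close>
  have disj: "(b, v) \<notin> E \<and> b \<noteq> v" if "(a, v) \<in> E" for v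
    using transD[OF E(3), of a v b] that s[of v b] nab ne by auto
  have d: "distinct [a, a1, a2, a3, b, b1, b2, b3]"
    using Aa Bb da db ne nab s[of a b] irr[of a] irr[of b]
      disj[OF Aa(1)] disj[OF Aa(2)] disj[OF Aa(3)] by auto
  \<comment> \<open>Reversing the list supplies every inequality in the other orientation as well,
    for use as rewrite rules.\<close>
  then have "distinct (rev [a, a1, a2, a3, b, b1, b2, b3])"
    by (simp only: distinct_rev)
  note neqs = d[simplified] this[simplified]
  have nbs: "E `` {a1} = {a, a2, a3}" "E `` {a2} = {a, a1, a3}" "E `` {a3} = {a, a1, a2}"
    "E `` {b1} = {b, b2, b3}" "E `` {b2} = {b, b1, b3}" "E `` {b3} = {b, b1, b2}"
    using d by (auto simp: nb[OF Aa(1)] nb[OF Aa(2)] nb[OF Aa(3)] nb[OF Bb(1)] nb[OF Bb(2)] nb[OF Bb(3)] A B)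
  \<comment> \<open>Arcs of \<open>E\<close> become membership in explicit sets, from either end, so
    that checking a move reduces to comparing vertices.\<close>
  have mem: "((u, v) \<in> E \<longleftrightarrow> v \<in> N) \<and> ((v, u) \<in> E \<longleftrightarrow> v \<in> N)" if "E `` {u} = N" for u v N
    using that s[of v u] by auto
  note adj = A[THEN mem] B[THEN mem] nbs[THEN mem]
  define G1 where "G1 = break_move G a1 a a2 b1 b"
  \<comment> \<open>The first break leaves the triangle on \<open>a1\<close>, \<open>a\<close>,
    \<open>a3\<close> intact, so \<open>a1\<close> can serve again as the third vertex.\<close>
  define G2 where "G2 = break_move G1 a1 a a3 b2 b"
  \<comment> \<open>The path \<open>a1 a b1 b3 b\<close> runs through the edge \<open>a b1\<close>
    created by the first break; its end edges are the last old ones at \<open>a\<close> and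
    \<open>b\<close>.\<close>
  define G3 where "G3 = make_move G2 a1 a b1 b3 b"
  have p1: "parcs G1 = E - (edge a a2 \<union> edge b1 b) \<union> (edge a b1 \<union> edge a2 b)"
    by (simp add: G1_def break_move_def replace_edges_def E_def)
  have p2: "parcs G2 = parcs G1 - (edge a a3 \<union> edge b2 b) \<union> (edge a b2 \<union> edge a3 b)"
    by (simp add: G2_def break_move_def replace_edges_def)
  have p3: "parcs G3 = parcs G2 - (edge a a1 \<union> edge b3 b) \<union> (edge a b3 \<union> edge a1 b)"
    by (simp add: G3_def make_move_def replace_edges_def)
  have "break_applies G a1 a a2 b1 b"
    by (simp add: break_applies_def E_def[symmetric] adj neqs)
  then have t1: "takes_to G G1"
    unfolding takes_to_def G1_def by blast
  have "break_applies G1 a1 a a3 b2 b"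
    by (simp add: break_applies_def p1 edge_def adj neqs)
  then have t2: "takes_to G1 G2"
    unfolding takes_to_def G2_def by blast
  have "make_applies G2 a1 a b1 b3 b"
    by (simp add: make_applies_def p2 p1 edge_def adj neqs)
  then have t3: "takes_to G2 G3"
    unfolding takes_to_def G3_def by blast
  have "(u, v) \<in> parcs G3 \<longleftrightarrow> (transpose a b u, transpose a b v) \<in> E" for u v
  proof -
    \<comment> \<open>Nine positions for each endpoint, hence 81 cases.\<close>
    have *: "w = a \<or> w = a1 \<or> w = a2 \<or> w = a3 \<or> w = b \<or> w = b1 \<or> w = b2 \<or> w = b3 \<or>
        w \<notin> {a, a1, a2, a3, b, b1, b2, b3}" for w
      by blast
    show ?thesis
      using *[of u] *[of v]
      by (elim disjE; simp add: p3 p2 p1 edge_def adj transpose_def neqs)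
  qed
  then have "parcs G3 = inv_image E (transpose a b)" by auto
  moreover have "pverts G3 = pverts G"
    by (simp add: G1_def G2_def G3_def break_move_def make_move_def replace_edges_def)
  ultimately have "G3 = G\<lparr>parcs := inv_image (parcs G) (transpose a b)\<rparr>"
    by (simp add: E_def)
  moreover interpret F: pair_graph "flip_graph n" by (rule pair_graph_flip_graph)
  have c1: "G1 \<in> cubic_graphs n" and c2: "G2 \<in> cubic_graphs n"
    using takes_to_in_cubic_graphs t1 t2 G by blast+
  have "G \<rightarrow>\<^sup>*\<^bsub>flip_graph n\<^esub> G3"
    using takes_to_reachable[OF G t1] takes_to_reachable[OF c1 t2] takes_to_reachable[OF c2 t3]
    by (blast intro: F.reachable_trans)
  ultimately show ?thesis by simp
qed

section \<open>Aligning one disjoint union of cliques with another\<close>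

lemma trans_reflcl_inv_image:
  assumes "trans (E\<^sup>=)" "inj f"
  shows "trans ((inv_image E f)\<^sup>=)"
proof -
  have "(inv_image E f)\<^sup>= = inv_image (E\<^sup>=) f"
    using assms(2) by (auto simp: inj_def)
  then show ?thesis using assms(1) by (simp add: trans_inv_image)
qed

text \<open>While \<open>u\<close> has a wrong neighbour \<open>x\<close> in \<open>G\<close> and
  misses a neighbour \<open>v\<close> from \<open>H\<close>, swapping \<open>x\<close> and
  \<open>v\<close> reduces the number of missing ones. The last conjunct protects finished vertices
  in the induction of \<open>reachable_cluster_graphs\<close>.\<close>

lemma reachable_align_block:
  assumes "G \<in> cubic_graphs n" "trans ((parcs G)\<^sup>=)"
    and H: "H \<in> cubic_graphs n" "trans ((parcs H)\<^sup>=)" and u: "u \<in> {1..n}"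
  shows "\<exists>G'. G \<rightarrow>\<^sup>*\<^bsub>flip_graph n\<^esub> G' \<and> trans ((parcs G')\<^sup>=) \<and>
    parcs G' `` {u} = parcs H `` {u} \<and>
    (\<forall>w. parcs G `` {w} = parcs H `` {w} \<longrightarrow> parcs G' `` {w} = parcs H `` {w})"
  using assms(1,2)
proof (induction "card (parcs H `` {u} - parcs G `` {u})" arbitrary: G rule: less_induct)
  case less
  interpret F: pair_graph "flip_graph n" by (rule pair_graph_flip_graph)
  note G = less.prems
  note RG = G(1)[unfolded cubic_graphs_iff] and RH = H(1)[unfolded cubic_graphs_iff]
  have sG: "(p, q) \<in> parcs G \<Longrightarrow> (q, p) \<in> parcs G"
    and sH: "(p, q) \<in> parcs H \<Longrightarrow> (q, p) \<in> parcs H" for p q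
    using G(1) H(1) by (auto intro: cubic_graphs_sym)
  have tG: "(p, q) \<in> parcs G \<Longrightarrow> (q, r) \<in> parcs G \<Longrightarrow> p \<noteq> r \<Longrightarrow> (p, r) \<in> parcs G"
    and tH: "(p, q) \<in> parcs H \<Longrightarrow> (q, r) \<in> parcs H \<Longrightarrow> p \<noteq> r \<Longrightarrow> (p, r) \<in> parcs H" for p q r
    using transD[OF G(2), of p q r] transD[OF H(2), of p q r] by auto
  have iG: "(p, p) \<notin> parcs G" and iH: "(p, p) \<notin> parcs H" for p
    using RG RH by (auto simp: irrefl_def)
  have finG: "finite (parcs G `` {u})" and finH: "finite (parcs H `` {u})"
    using RG RH u by (auto intro: card_ge_0_finite)
  show ?case
  proof (cases "parcs G `` {u} = parcs H `` {u}")
    case True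
    have "G \<rightarrow>\<^sup>*\<^bsub>flip_graph n\<^esub> G" using G(1) by (intro F.reachable_refl) (simp add: flip_graph_def)
    with True G(2) show ?thesis by blast
  next
    case False
    have card_eq: "card (parcs G `` {u}) = card (parcs H `` {u})" using RG RH u by simp
    \<comment> \<open>Distinct finite sets of equal size do not contain one another, which gives
      both \<open>v\<close> and \<open>x\<close>.\<close>
    obtain v where v: "(u, v) \<in> parcs H" "(u, v) \<notin> parcs G"
      using card_subset_eq[OF finG, of "parcs H `` {u}"] card_eq False by auto
    obtain x where x: "(u, x) \<in> parcs G" "(u, x) \<notin> parcs H"
      using card_subset_eq[OF finH, of "parcs G `` {u}"] card_eq False by auto
    have ne: "u \<noteq> v" "u \<noteq> x" "x \<noteq> v" using v x iG iH by auto
    have nadj: "(x, v) \<notin> parcs G" using tG[OF x(1)] v(2) ne by blast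
    have V: "x \<in> {1..n}" "v \<in> {1..n}" using RG RH v(1) x(1) by auto
    let ?t = "transpose x v"
    define G1 where "G1 = G\<lparr>parcs := inv_image (parcs G) ?t\<rparr>"
    have mem: "(p, q) \<in> parcs G1 \<longleftrightarrow> (?t p, ?t q) \<in> parcs G" for p q
      by (simp add: G1_def)
    have r1: "G \<rightarrow>\<^sup>*\<^bsub>flip_graph n\<^esub> G1"
      unfolding G1_def using reachable_transpose[OF G V ne(3) nadj] .
    \<comment> \<open>Cubicity is read off from reachability: the end of a walk is a vertex of
      \<open>flip_graph n\<close>.\<close>
    have c1: "G1 \<in> cubic_graphs n"
      using F.reachable_in_verts(2)[OF r1] by (simp add: flip_graph_def)
    have t1: "trans ((parcs G1)\<^sup>=)"
      using trans_reflcl_inv_image[OF G(2) inj_transpose[of x v]] by (simp add: G1_def)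
    \<comment> \<open>A finished \<open>w\<close> is not adjacent to \<open>u\<close>, since
      otherwise \<open>H\<close> would join \<open>u\<close> to \<open>x\<close>. Hence
      \<open>w\<close> is neither \<open>x\<close> nor \<open>v\<close> nor adjacent to them in
      \<open>G\<close>, and the swap does not affect its neighbourhood.\<close>
    have keep: "parcs G1 `` {w} = parcs H `` {w}" if w: "parcs G `` {w} = parcs H `` {w}" for w
    proof -
      have same: "(w, q) \<in> parcs G \<longleftrightarrow> (w, q) \<in> parcs H" for q using w by blast
      have "w \<noteq> u" using False w by blast
      have "(w, u) \<notin> parcs G"
      proof
        assume wu: "(w, u) \<in> parcs G"
        have "(w, x) \<in> parcs G \<or> w = x" using tG[OF wu x(1)] by blast
        then have "(u, x) \<in> parcs H"
          using same wu sH tH ne by metis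
        with x(2) show False by blast
      qed
      then have "w \<noteq> x" "w \<noteq> v" "(w, x) \<notin> parcs G" "(w, v) \<notin> parcs G"
        using sG[OF x(1)] sH[OF v(1)] same tG tH \<open>w \<noteq> u\<close> by blast+
      then have "(w, q) \<in> parcs G1 \<longleftrightarrow> (w, q) \<in> parcs G" for q
        by (auto simp: mem transpose_def)
      with same show ?thesis by blast
    qed
    have "parcs G1 `` {u} = insert v (parcs G `` {u}) - {x}"
      using ne x(1) v(2) by (auto simp: mem transpose_def split: if_splits)
    \<comment> \<open>The difference loses \<open>v\<close>, and the discarded \<open>x\<close>
      cannot enter it because it is no neighbour of \<open>u\<close> in \<open>H\<close>.\<close>
    then have "parcs H `` {u} - parcs G1 `` {u} \<subset> parcs H `` {u} - parcs G `` {u}"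
      using v x by auto
    then have "card (parcs H `` {u} - parcs G1 `` {u}) < card (parcs H `` {u} - parcs G `` {u})"
      using finH by (intro psubset_card_mono) auto
    from less.hyps[OF this c1 t1] obtain G' where G': "G1 \<rightarrow>\<^sup>*\<^bsub>flip_graph n\<^esub> G'"
      "trans ((parcs G')\<^sup>=)" "parcs G' `` {u} = parcs H `` {u}"
      "\<And>w. parcs G1 `` {w} = parcs H `` {w} \<Longrightarrow> parcs G' `` {w} = parcs H `` {w}"
      by metis
    from G'(2,3,4) F.reachable_trans[OF r1 G'(1)] keep show ?thesis
      by (intro exI[of _ G'] conjI allI impI) (assumption | blast)+
  qed
qed

text \<open>Aligning a vertex \<open>u\<close> with a wrong neighbourhood corrects \<open>u\<close>
  and spoils no finished vertex, so the number of wrong vertices drops.\<close>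

lemma reachable_cluster_graphs:
  assumes "G \<in> cubic_graphs n" "trans ((parcs G)\<^sup>=)"
    and H: "H \<in> cubic_graphs n" "trans ((parcs H)\<^sup>=)"
  shows "G \<rightarrow>\<^sup>*\<^bsub>flip_graph n\<^esub> H"
  using assms(1,2)
proof (induction "card {w \<in> {1..n}. parcs G `` {w} \<noteq> parcs H `` {w}}" arbitrary: G rule: less_induct)
  case less
  interpret F: pair_graph "flip_graph n" by (rule pair_graph_flip_graph)
  note RG = less.prems(1)[unfolded cubic_graphs_iff] and RH = H(1)[unfolded cubic_graphs_iff]
  show ?case
  proof (cases "\<exists>u\<in>{1..n}. parcs G `` {u} \<noteq> parcs H `` {u}")
    case True
    then obtain u where u: "u \<in> {1..n}" "parcs G `` {u} \<noteq> parcs H `` {u}" by blast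
    obtain G' where G': "G \<rightarrow>\<^sup>*\<^bsub>flip_graph n\<^esub> G'" "trans ((parcs G')\<^sup>=)"
      "parcs G' `` {u} = parcs H `` {u}"
      "\<And>w. parcs G `` {w} = parcs H `` {w} \<Longrightarrow> parcs G' `` {w} = parcs H `` {w}"
      using reachable_align_block[OF less.prems H u(1)] by blast
    have c: "G' \<in> cubic_graphs n"
      using F.reachable_in_verts(2)[OF G'(1)] by (simp add: flip_graph_def)
    have "card {w \<in> {1..n}. parcs G' `` {w} \<noteq> parcs H `` {w}}
        < card {w \<in> {1..n}. parcs G `` {w} \<noteq> parcs H `` {w}}"
      using u G'(3,4) by (intro psubset_card_mono) auto
    from less.hyps[OF this c G'(2)] show ?thesis
      using G'(1) by (blast intro: F.reachable_trans)
  next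
    case False
    then have "(p, q) \<in> parcs G \<longleftrightarrow> (p, q) \<in> parcs H" for p q
      using RG RH by blast
    then have "parcs G = parcs H" by auto
    then have "G = H" using RG RH by simp
    moreover have "H \<rightarrow>\<^sup>*\<^bsub>flip_graph n\<^esub> H"
      using H(1) by (intro F.reachable_refl) (simp add: flip_graph_def)
    ultimately show ?thesis by simp
  qed
qed

section \<open>From components isomorphic to \<open>K4\<close> to transitivity\<close>

text \<open>The ends of a path \<open>u v w\<close> lie in one component, and in a copy of
  \<open>K4\<close> any two distinct vertices are joined.\<close>

lemma K4_graphs_trans:
  assumes "G \<in> K4_graphs n"
  shows "trans ((parcs G)\<^sup>=)"
proof -
  interpret pair_graph G using assms by (simp add: K4_graphs_def cubic_graphs_def)
  have "(u, w) \<in> parcs G" if uv: "(u, v) \<in> parcs G" and vw: "(v, w) \<in> parcs G" and ne: "u \<noteq> w" for u v w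
  proof -
    define C where "C = with_proj G \<restriction> {x. u \<rightarrow>\<^sup>*\<^bsub>G\<^esub> x}"
    have "u \<in> pverts G" using uv by (rule in_arcsD1)
    then have "C \<in> sccs" unfolding C_def by (intro induce_reachable_is_in_sccs) simp
    then have "digraph_iso C (with_proj K4)" using assms by (simp add: K4_graphs_def)
    then obtain f where f: "pre_digraph.digraph_isomorphism C f" and K: "with_proj K4 = app_iso f C"
      unfolding digraph_iso_def by blast
    have "u \<rightarrow>\<^sup>*\<^bsub>G\<^esub> w"
      using uv vw by (metis reachable_adjI reachable_adj_trans with_proj_simps(3))
    then have mem: "u \<in> verts C" "w \<in> verts C"
      using \<open>u \<in> pverts G\<close> by (simp_all add: C_def)
    have inj: "inj_on (iso_verts f) (verts C)" and wf: "wf_digraph C"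
      using f by (auto simp: pre_digraph.digraph_isomorphism_def)
    have "iso_verts f u \<in> pverts K4" "iso_verts f w \<in> pverts K4"
      using K mem by (metis imageI verts_app_iso with_proj_simps(1))+
    moreover have "iso_verts f u \<noteq> iso_verts f w"
      using inj mem ne by (auto dest: inj_onD)
    ultimately have "(iso_verts f u, iso_verts f w) \<in> arcs_ends (with_proj K4)"
      by (simp add: K4_def)
    \<comment> \<open>The arc of \<open>K4\<close> pulls back to an arc of \<open>C\<close> between
      vertices with the same images; injectivity then identifies them with \<open>u\<close> and
      \<open>w\<close>.\<close>
    then obtain p q where pq: "(p, q) \<in> arcs_ends C" "iso_verts f u = iso_verts f p" "iso_verts f w = iso_verts f q"
      unfolding K wf_digraph.arcs_ends_app_iso_eq[OF wf f] by auto
    then have "p \<in> verts C" "q \<in> verts C" "(p, q) \<in> parcs G"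
      by (auto simp: C_def arcs_ends_conv)
    then show ?thesis using pq mem inj by (auto dest: inj_onD)
  qed
  then show ?thesis by (intro transI) blast
qed

theorem theorem8:
  fixes n :: nat and G G' :: "nat pair_pre_digraph"
  assumes "n mod 4 = 0"
    and "G \<in> K4_graphs n" and "G' \<in> K4_graphs n"
  shows "\<exists>p. pre_digraph.apath (with_proj (flip_graph n)) G p G'"
proof -
  interpret F: pair_graph "flip_graph n" by (rule pair_graph_flip_graph)
  have "G \<in> cubic_graphs n" "G' \<in> cubic_graphs n"
    using assms by (auto simp: K4_graphs_def)
  then show ?thesis
    \<comment> \<open>Read backwards, \<open>F.reachable_apath\<close> turns the existence of a path
      into reachability.\<close>
    using reachable_cluster_graphs K4_graphs_trans assms by (simp flip: F.reachable_apath)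
qed

end
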